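(* Let $\mathcal A$ be any unitary operator on $\mathcal H$ (a quantum algorithm that uses no measurements), and let $\chi:\mathbb Z\to\{0,1\}$ be any Boolean function. Let $a$ be the probability that measuring $\mathcal A|\mathbf 0\rangle$ produces a good state, and let $\theta$ be defined by $\sin^2\theta=a$ and $0\le\theta\le\pi/2$. Let $\mathbf Q=-\mathcal A\,\mathbf S_0\,\mathcal A^{-1}\,\mathbf S_\chi$. Suppose $a>0$ and set $m=\lfloor\pi/(4\theta)\rfloor$. Then, if we compute $\mathbf Q^m\mathcal A|\mathbf 0\rangle$ and measure the system, the outcome is good with probability at least $\max(1-a,a)$.
   Context: Setting. $\mathcal H$ is the state space of a joint quantum system whose first subsystem has orthonormal basis states $|i\rangle$ indexed by integers $i$; every pure state is a superposition $\sum_{i\in\mathbb Z}x_i|i\rangle|\Upsilon_i\rangle$ with only finitely many nonzero amplitudes $x_i$. $|\mathbf 0\rangle\in\mathcal H$ is the fixed all-zero initial state (a unit vector). Given $\chi:\mathbb Z\to\{0,1\}$, a state $|i\rangle|\cdot\rangle$ is good if $\chi(i)=1$ and bad if $\chi(i)=0$. The probability that measuring a state $|\Upsilon\rangle$ gives a good outcome is $\langle\Upsilon^a|\Upsilon^a\rangle$, where $|\Upsilon^a\rangle$ is the orthogonal projection of $|\Upsilon\rangle$ onto the span of the good states. $\mathbf S_\chi$ is the unitary with $|i\rangle|\cdot\rangle\mapsto(-1)^{\chi(i)}|i\rangle|\cdot\rangle$, and $\mathbf S_0=\mathbf I-2|\mathbf 0\rangle\langle\mathbf 0|$. *)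

theory Defs
  imports Complex_Main "HOL-Library.Poly_Mapping"
begin

text \<open>Complex inner product spaces, not necessarily complete. Following the convention of
  Dirac notation, the inner product is antilinear in its first argument and linear in its second.\<close>

class complex_inner = ab_group_add +
  fixes scaleC :: "complex \<Rightarrow> 'a \<Rightarrow> 'a"  (infixr \<open>*\<^sub>C\<close> 75)
    and cinner :: "'a \<Rightarrow> 'a \<Rightarrow> complex"
  assumes scaleC_add_right: "c *\<^sub>C (x + y) = c *\<^sub>C x + c *\<^sub>C y"
    and scaleC_add_left: "(c + d) *\<^sub>C x = c *\<^sub>C x + d *\<^sub>C x"
    and scaleC_scaleC: "c *\<^sub>C d *\<^sub>C x = (c * d) *\<^sub>C x"
    and scaleC_one: "1 *\<^sub>C x = x"
    and cinner_commute: "cinner x y = cnj (cinner y x)"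
    and cinner_add_right: "cinner x (y + z) = cinner x y + cinner x z"
    and cinner_scaleC_right: "cinner x (c *\<^sub>C y) = c * cinner x y"
    and cinner_self_pos: "x \<noteq> 0 \<Longrightarrow> 0 < Re (cinner x x)"

global_interpretation cvec: vector_space "scaleC :: complex \<Rightarrow> 'a \<Rightarrow> 'a :: complex_inner"
  by unfold_locales (rule scaleC_add_right scaleC_add_left scaleC_scaleC scaleC_one)+

instantiation complex :: complex_inner
begin

definition scaleC_complex :: "complex \<Rightarrow> complex \<Rightarrow> complex"
  where "scaleC_complex c x = c * x"

definition cinner_complex :: "complex \<Rightarrow> complex \<Rightarrow> complex"
  where "cinner_complex x y = cnj x * y"

instance
  by standard
    (auto simp: scaleC_complex_def cinner_complex_def algebra_simps complex_eq_iff
      simp flip: power2_eq_square simp: sum_power2_gt_zero_iff)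

end

text \<open>The state space of the joint system is \<open>int \<Rightarrow>\<^sub>0 'k\<close>, where \<open>'k\<close> is the state space of the
  second subsystem: the finitely supported family with entries \<open>x\<^sub>i \<Upsilon>\<^sub>i\<close> stands for the finite
  superposition \<open>\<Sum>i. x\<^sub>i |i\<rangle>|\<Upsilon>\<^sub>i\<rangle>\<close>. In particular \<open>|i\<rangle>|v\<rangle>\<close> is \<open>Poly_Mapping.single i v\<close>.\<close>

instantiation poly_mapping :: (type, complex_inner) complex_inner
begin

definition scaleC_poly_mapping :: "complex \<Rightarrow> ('a \<Rightarrow>\<^sub>0 'b) \<Rightarrow> ('a \<Rightarrow>\<^sub>0 'b)"
  where "c *\<^sub>C x = Poly_Mapping.map (scaleC c) x"

definition cinner_poly_mapping :: "('a \<Rightarrow>\<^sub>0 'b) \<Rightarrow> ('a \<Rightarrow>\<^sub>0 'b) \<Rightarrow> complex"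
  where "cinner x y = (\<Sum>i\<in>Poly_Mapping.keys x.
    cinner (Poly_Mapping.lookup x i) (Poly_Mapping.lookup y i))"

instance
proof
  fix x y z :: "'a \<Rightarrow>\<^sub>0 'b" and c d :: complex
  have lookup_scaleC: "Poly_Mapping.lookup (c *\<^sub>C x) i = c *\<^sub>C Poly_Mapping.lookup x i"
    for c i and x :: "'a \<Rightarrow>\<^sub>0 'b"
    by (simp add: scaleC_poly_mapping_def map.rep_eq when_def)
  have cinner_zero_right: "cinner u 0 = 0" for u :: 'b
    using cinner_add_right[of u 0 0] by simp
  have cinner_zero_left: "cinner 0 u = 0" for u :: 'b
    using cinner_commute[of 0 u] by (simp add: cinner_zero_right)
  have cinner_superset:
    "cinner x y = (\<Sum>i\<in>F. cinner (Poly_Mapping.lookup x i) (Poly_Mapping.lookup y i))"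
    if "finite F" "Poly_Mapping.keys x \<subseteq> F" for F and x y :: "'a \<Rightarrow>\<^sub>0 'b"
    unfolding cinner_poly_mapping_def using that
    by (intro sum.mono_neutral_left) (auto simp: in_keys_iff cinner_zero_left)
  show "c *\<^sub>C (x + y) = c *\<^sub>C x + c *\<^sub>C y"
    by (rule poly_mapping_eqI) (simp add: lookup_scaleC lookup_add scaleC_add_right)
  show "(c + d) *\<^sub>C x = c *\<^sub>C x + d *\<^sub>C x"
    by (rule poly_mapping_eqI) (simp add: lookup_scaleC lookup_add scaleC_add_left)
  show "c *\<^sub>C d *\<^sub>C x = (c * d) *\<^sub>C x"
    by (rule poly_mapping_eqI) (simp add: lookup_scaleC scaleC_scaleC)
  show "1 *\<^sub>C x = x"
    by (rule poly_mapping_eqI) (simp add: lookup_scaleC scaleC_one)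
  show "cinner x y = cnj (cinner y x)"
  proof -
    let ?F = "Poly_Mapping.keys x \<union> Poly_Mapping.keys y"
    have "cinner x y = (\<Sum>i\<in>?F. cinner (Poly_Mapping.lookup x i) (Poly_Mapping.lookup y i))"
      by (rule cinner_superset) auto
    also have "\<dots> = (\<Sum>i\<in>?F. cnj (cinner (Poly_Mapping.lookup y i) (Poly_Mapping.lookup x i)))"
      by (rule sum.cong[OF refl], rule cinner_commute)
    also have "\<dots> = cnj (\<Sum>i\<in>?F. cinner (Poly_Mapping.lookup y i) (Poly_Mapping.lookup x i))"
      by (simp add: cnj_sum)
    also have "\<dots> = cnj (cinner y x)"
      by (rule arg_cong[where f = cnj], rule cinner_superset[symmetric]) auto
    finally show ?thesis .
  qed
  show "cinner x (y + z) = cinner x y + cinner x z"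
    by (simp add: cinner_poly_mapping_def lookup_add cinner_add_right sum.distrib)
  show "cinner x (c *\<^sub>C y) = c * cinner x y"
    by (simp add: cinner_poly_mapping_def lookup_scaleC cinner_scaleC_right sum_distrib_left)
  show "0 < Re (cinner x x)" if "x \<noteq> 0"
    unfolding cinner_poly_mapping_def Re_sum using that
    by (intro sum_pos) (auto simp: in_keys_iff intro: cinner_self_pos)
qed

end

definition unitary :: "('h::complex_inner \<Rightarrow> 'h) \<Rightarrow> bool" where
  "unitary U \<longleftrightarrow> Vector_Spaces.linear scaleC scaleC U \<and> bij U \<and>
     (\<forall>x y. cinner (U x) (U y) = cinner x y)"

text \<open>Without completeness an orthogonal projection need not exist for every subspace;
  \<open>orth_proj_good_subspace\<close> below shows that it does for the subspaces considered here.\<close>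

definition orth_proj :: "'h::complex_inner set \<Rightarrow> 'h \<Rightarrow> 'h" where
  "orth_proj S x = (THE p. p \<in> S \<and> (\<forall>s\<in>S. cinner s (x - p) = 0))"

definition good_subspace :: "(int \<Rightarrow> bool) \<Rightarrow> (int \<Rightarrow>\<^sub>0 'k::complex_inner) set" where
  "good_subspace \<chi> = cvec.span {Poly_Mapping.single i v | i v. \<chi> i}"

definition prob_good :: "(int \<Rightarrow> bool) \<Rightarrow> (int \<Rightarrow>\<^sub>0 'k::complex_inner) \<Rightarrow> real" where
  "prob_good \<chi> x =
     Re (cinner (orth_proj (good_subspace \<chi>) x) (orth_proj (good_subspace \<chi>) x))"

text \<open>\<open>Poly_Mapping.mapp\<close> applies an index-dependent function to every entry, so \<open>S_chi\<close> is the
  linear extension of \<open>|i\<rangle>|v\<rangle> \<mapsto> (-1)\<^sup>\<chi>\<^sup>(\<^sup>i\<^sup>) |i\<rangle>|v\<rangle>\<close>; see \<open>S_chi_single\<close> and \<open>unitary_S_chi\<close>.\<close>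

definition S_chi :: "(int \<Rightarrow> bool) \<Rightarrow> (int \<Rightarrow>\<^sub>0 'k::complex_inner) \<Rightarrow> (int \<Rightarrow>\<^sub>0 'k)" where
  "S_chi \<chi> = Poly_Mapping.mapp (\<lambda>i v. (- 1) ^ of_bool (\<chi> i) *\<^sub>C v)"

definition S_zero :: "'h::complex_inner \<Rightarrow> 'h \<Rightarrow> 'h" where
  "S_zero ket0 x = x - (2 * cinner ket0 x) *\<^sub>C ket0"

definition Q_op :: "((int \<Rightarrow>\<^sub>0 'k::complex_inner) \<Rightarrow> (int \<Rightarrow>\<^sub>0 'k)) \<Rightarrow> (int \<Rightarrow>\<^sub>0 'k) \<Rightarrow>
    (int \<Rightarrow> bool) \<Rightarrow> (int \<Rightarrow>\<^sub>0 'k) \<Rightarrow> (int \<Rightarrow>\<^sub>0 'k)" where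
  "Q_op A ket0 \<chi> x = - A (S_zero ket0 (inv A (S_chi \<chi> x)))"

lemma cinner_add_left: "cinner (x + y) z = cinner x z + cinner y (z :: 'a :: complex_inner)"
  by (metis cinner_add_right cinner_commute complex_cnj_add)

lemma cinner_scaleC_left: "cinner (c *\<^sub>C x) y = cnj c * cinner x (y :: 'a :: complex_inner)"
  by (metis cinner_commute cinner_scaleC_right complex_cnj_mult)

lemma cinner_zero_right [simp]: "cinner x (0 :: 'a :: complex_inner) = 0"
  using cinner_add_right[of x 0 0] by simp

lemma cinner_zero_left [simp]: "cinner (0 :: 'a :: complex_inner) x = 0"
  using cinner_add_left[of 0 0 x] by simp

lemma cinner_diff_right: "cinner x (y - z) = cinner x y - cinner x (z :: 'a :: complex_inner)"
  by (metis add_diff_cancel cinner_add_right diff_add_cancel)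

lemma cinner_self_eq_0_iff [simp]: "cinner x x = 0 \<longleftrightarrow> x = (0 :: 'a :: complex_inner)"
  by (metis cinner_self_pos cinner_zero_left less_irrefl zero_complex.sel(1))

lemma lookup_scaleC [simp]:
  "Poly_Mapping.lookup (c *\<^sub>C x) i = c *\<^sub>C Poly_Mapping.lookup x i"
  by (simp add: scaleC_poly_mapping_def map.rep_eq when_def)

lemma lookup_S_chi:
  "Poly_Mapping.lookup (S_chi \<chi> x) i = (- 1) ^ of_bool (\<chi> i) *\<^sub>C Poly_Mapping.lookup x i"
  by (simp add: S_chi_def lookup_mapp when_def in_keys_iff)

lemma S_chi_single:
  "S_chi \<chi> (Poly_Mapping.single i v) = (- 1) ^ of_bool (\<chi> i) *\<^sub>C Poly_Mapping.single i v"
  by (rule poly_mapping_eqI) (simp add: lookup_S_chi lookup_single when_def)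

lemma S_chi_S_chi: "S_chi \<chi> (S_chi \<chi> x) = x"
  by (rule poly_mapping_eqI)
    (simp add: lookup_S_chi cvec.scale_scale flip: power_mult_distrib)

lemma unitary_S_chi: "unitary (S_chi \<chi> :: (int \<Rightarrow>\<^sub>0 'k::complex_inner) \<Rightarrow> _)"
proof -
  have keys: "Poly_Mapping.keys (S_chi \<chi> x) = Poly_Mapping.keys x" for x :: "int \<Rightarrow>\<^sub>0 'k"
    by (auto simp: in_keys_iff lookup_S_chi)
  have "Vector_Spaces.linear scaleC scaleC (S_chi \<chi> :: (int \<Rightarrow>\<^sub>0 'k) \<Rightarrow> _)"
    by unfold_locales
      (auto intro!: poly_mapping_eqI
        simp: lookup_S_chi lookup_add cvec.scale_right_distrib mult.commute)
  moreover have "bij (S_chi \<chi> :: (int \<Rightarrow>\<^sub>0 'k) \<Rightarrow> _)"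
    by (rule involuntory_imp_bij) (rule S_chi_S_chi)
  moreover have "cinner (S_chi \<chi> x) (S_chi \<chi> y) = cinner x y" for x y :: "int \<Rightarrow>\<^sub>0 'k"
    unfolding cinner_poly_mapping_def keys
    by (intro sum.cong refl)
      (auto simp: lookup_S_chi cinner_scaleC_left cinner_scaleC_right)
  ultimately show ?thesis by (simp add: unitary_def)
qed

lemma orth_proj_eqI:
  assumes S: "cvec.subspace S" and p: "p \<in> S" "\<And>s. s \<in> S \<Longrightarrow> cinner s (x - p) = 0"
  shows "orth_proj S x = p"
  unfolding orth_proj_def
proof (rule the_equality)
  show "p \<in> S \<and> (\<forall>s\<in>S. cinner s (x - p) = 0)" using p by blast
next
  fix q assume q: "q \<in> S \<and> (\<forall>s\<in>S. cinner s (x - q) = 0)"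
  have "q - p \<in> S" using S p q by (simp add: cvec.subspace_diff)
  then have "cinner (q - p) (x - p) = 0" "cinner (q - p) (x - q) = 0"
    using p q by auto
  then have "cinner (q - p) ((x - p) - (x - q)) = 0"
    by (simp add: cinner_diff_right)
  then show "q = p" by simp
qed

lemma orth_proj_good_subspace:
  fixes x :: "int \<Rightarrow>\<^sub>0 'k::complex_inner"
  shows "orth_proj (good_subspace \<chi>) x = Poly_Mapping.mapp (\<lambda>i v. if \<chi> i then v else 0) x"
    (is "_ = ?p")
proof (rule orth_proj_eqI)
  show "cvec.subspace (good_subspace \<chi> :: (int \<Rightarrow>\<^sub>0 'k) set)"
    by (simp add: good_subspace_def)
  have lookup_p: "Poly_Mapping.lookup ?p i = (if \<chi> i then Poly_Mapping.lookup x i else 0)" for i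
    by (simp add: lookup_mapp when_def in_keys_iff)
  have "?p = (\<Sum>i\<in>Poly_Mapping.keys ?p. Poly_Mapping.single i (Poly_Mapping.lookup ?p i))"
    by (rule poly_mapping_eqI)
      (simp add: lookup_sum lookup_single when_def sum.delta in_keys_iff)
  moreover have "\<chi> i" if "i \<in> Poly_Mapping.keys ?p" for i
    using that by (simp add: in_keys_iff lookup_p split: if_splits)
  ultimately show "?p \<in> good_subspace \<chi>"
    unfolding good_subspace_def
    by (smt (verit, best) cvec.span_base cvec.span_sum mem_Collect_eq)
  fix s :: "int \<Rightarrow>\<^sub>0 'k" assume "s \<in> good_subspace \<chi>"
  then show "cinner s (x - ?p) = 0"
    unfolding good_subspace_def
  proof (induction rule: cvec.span_induct_alt)
    case base
    show ?case by simp
  next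
    case (step c b y)
    then obtain i v where b: "b = Poly_Mapping.single i v" and i: "\<chi> i" by blast
    have "cinner b (x - ?p) = 0"
      unfolding b cinner_poly_mapping_def using i by (simp add: lookup_minus lookup_p)
    with step show ?case by (simp add: cinner_add_left cinner_scaleC_left)
  qed
qed

end

theory Submission
  imports Defs
begin

text \<open>
  Split \<open>\<psi> = A |0\<rangle>\<close> into its good part \<open>g\<close> and its bad part \<open>b\<close>. Since \<open>A S\<^sub>0 A\<^sup>-\<^sup>1\<close> is the reflection
  \<open>y \<mapsto> y - 2\<langle>\<psi>,y\<rangle>\<psi>\<close>, the operator \<open>Q\<close> preserves the plane spanned by \<open>g\<close> and \<open>b\<close> and acts on it as the
  rotation by \<open>2\<theta>\<close>, so that \<open>Q\<^sup>j \<psi>\<close> is good with probability \<open>sin\<^sup>2((2j+1)\<theta>)\<close>. By the choice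
  of \<open>m\<close>, the angle \<open>(2m+1)\<theta>\<close> differs from \<open>\<pi>/2\<close> by at most \<open>\<theta>\<close>, so this probability is at least \<open>cos\<^sup>2 \<theta> = 1 - a\<close>.
  The latter is at least \<open>a\<close> unless \<open>\<theta> > \<pi>/4\<close>, in which case \<open>m = 0\<close> and the probability is \<open>a\<close>.
\<close>

abbreviation good_part ::
    "(int \<Rightarrow> bool) \<Rightarrow> (int \<Rightarrow>\<^sub>0 'k::complex_inner) \<Rightarrow> (int \<Rightarrow>\<^sub>0 'k)" where
  "good_part \<chi> \<equiv> orth_proj (good_subspace \<chi>)"

lemma lookup_good_part:
  "Poly_Mapping.lookup (good_part \<chi> x) i = (if \<chi> i then Poly_Mapping.lookup x i else 0)"
  by (simp add: orth_proj_good_subspace lookup_mapp when_def in_keys_iff)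

lemma good_part_add: "good_part \<chi> (x + y) = good_part \<chi> x + good_part \<chi> y"
  by (rule poly_mapping_eqI) (simp add: lookup_good_part lookup_add)

lemma good_part_diff: "good_part \<chi> (x - y) = good_part \<chi> x - good_part \<chi> y"
  by (rule poly_mapping_eqI) (simp add: lookup_good_part lookup_minus)

lemma good_part_scaleC: "good_part \<chi> (c *\<^sub>C x) = c *\<^sub>C good_part \<chi> x"
  by (rule poly_mapping_eqI) (simp add: lookup_good_part)

lemma good_part_idem [simp]: "good_part \<chi> (good_part \<chi> x) = good_part \<chi> x"
  by (rule poly_mapping_eqI) (simp add: lookup_good_part)

lemma good_part_self_adjoint: "cinner (good_part \<chi> x) y = cinner x (good_part \<chi> y)"
proof -
  have "cinner (good_part \<chi> x) y = (\<Sum>i\<in>Poly_Mapping.keys x.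
      cinner (Poly_Mapping.lookup (good_part \<chi> x) i) (Poly_Mapping.lookup y i))"
    unfolding cinner_poly_mapping_def
    by (rule sum.mono_neutral_left)
      (auto simp: in_keys_iff lookup_good_part split: if_splits)
  also have "\<dots> = cinner x (good_part \<chi> y)"
    unfolding cinner_poly_mapping_def by (rule sum.cong) (auto simp: lookup_good_part)
  finally show ?thesis .
qed

lemma S_chi_eq_good_part: "S_chi \<chi> x = x - 2 *\<^sub>C good_part \<chi> x"
proof (rule poly_mapping_eqI)
  have "(- 1) *\<^sub>C v = v - 2 *\<^sub>C v" for v :: 'a
    using cvec.scale_left_diff_distrib[of 1 2 v] by simp
  then show "Poly_Mapping.lookup (S_chi \<chi> x) i = Poly_Mapping.lookup (x - 2 *\<^sub>C good_part \<chi> x) i" for i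
    by (simp add: lookup_S_chi lookup_minus lookup_good_part)
qed

lemma cinner_self_of_real: "cinner x x = of_real (Re (cinner x x))"
  using cinner_commute[of x x] by (simp add: complex_eq_iff)

text \<open>The projection P is self-adjoint and idempotent, so <x, P x> = <P x, P x>, which is
  real.\<close>

lemma cinner_good_part: "cinner x (good_part \<chi> x) = of_real (prob_good \<chi> x)"
  unfolding prob_good_def
  by (subst cinner_self_of_real[symmetric]) (simp add: good_part_self_adjoint)

text \<open>The projection kills \<open>x - good_part \<chi> x\<close>, so only the coefficient of
  the good part matters and \<open>c\<close> may be any complex number.\<close>

lemma prob_good_combination:
  "prob_good \<chi> (of_real u *\<^sub>C good_part \<chi> x + c *\<^sub>C (x - good_part \<chi> x)) = u\<^sup>2 * prob_good \<chi> x"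
  unfolding prob_good_def
  by (simp add: good_part_add good_part_diff good_part_scaleC cinner_scaleC_left
      cinner_scaleC_right power2_eq_square)

text \<open>Unitarity turns the overlap of \<open>v\<close> with \<open>inv A y\<close> into that of
  \<open>A v\<close> with \<open>y\<close>; conjugation by \<open>A\<close> thus carries the
  reflection along \<open>v\<close> to the one along \<open>A v\<close>.\<close>

lemma unitary_conj_S_zero:
  assumes "unitary A"
  shows "A (S_zero v (inv A y)) = y - (2 * cinner (A v) y) *\<^sub>C A v"
proof -
  interpret A: Vector_Spaces.linear scaleC scaleC A
    using assms by (simp add: unitary_def)
  have surj: "A (inv A y) = y"
    using assms by (simp add: unitary_def bij_is_surj surj_f_inv_f)
  have "cinner v (inv A y) = cinner (A v) y"
    using assms surj by (metis unitary_def)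
  then show ?thesis
    by (simp add: S_zero_def A.diff A.scale surj)
qed

text \<open>The overlaps of \<open>A ket0\<close> with \<open>g\<close> and with
  \<open>A ket0 - g\<close> are \<open>p\<close> and \<open>1 - p\<close>; they determine the matrix
  of \<open>Q\<close> on the plane. Leaving both vectors unnormalised avoids division, so the
  formula also covers the case where one of them is zero.\<close>

lemma Q_op_combination:
  fixes A :: "(int \<Rightarrow>\<^sub>0 'k::complex_inner) \<Rightarrow> (int \<Rightarrow>\<^sub>0 'k)"
    and \<chi> :: "int \<Rightarrow> bool" and c d :: complex
  assumes "cinner ket0 ket0 = 1" and "unitary A"
  defines "g \<equiv> good_part \<chi> (A ket0)" and "p \<equiv> of_real (prob_good \<chi> (A ket0))"
  shows "Q_op A ket0 \<chi> (c *\<^sub>C g + d *\<^sub>C (A ket0 - g)) =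
    ((1 - 2 * p) * c + 2 * (1 - p) * d) *\<^sub>C g +
    ((1 - 2 * p) * d - 2 * p * c) *\<^sub>C (A ket0 - g)"
proof -
  define b where "b = A ket0 - g"
  have psi: "A ket0 = g + b" by (simp add: b_def)
  have norm: "cinner (A ket0) (A ket0) = 1"
    using assms by (simp add: unitary_def)
  have g: "cinner (A ket0) g = p"
    by (simp add: g_def p_def cinner_good_part)
  have b: "cinner (A ket0) b = 1 - p"
    by (simp add: b_def cinner_diff_right norm g)
  have "good_part \<chi> (c *\<^sub>C g + d *\<^sub>C b) = c *\<^sub>C g"
    by (simp add: good_part_add good_part_diff good_part_scaleC g_def b_def)
  then have S: "S_chi \<chi> (c *\<^sub>C g + d *\<^sub>C b) = d *\<^sub>C b - c *\<^sub>C g"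
    using cvec.scale_left_distrib[of c c g] by (simp add: S_chi_eq_good_part)
  define k where "k = (1 - p) * d - p * c"
  have k: "cinner (A ket0) (d *\<^sub>C b - c *\<^sub>C g) = k"
    by (simp add: cinner_diff_right cinner_scaleC_right g b k_def)
  have "Q_op A ket0 \<chi> (c *\<^sub>C g + d *\<^sub>C b) = - (d *\<^sub>C b - c *\<^sub>C g - (2 * k) *\<^sub>C A ket0)"
    unfolding Q_op_def S unitary_conj_S_zero[OF \<open>unitary A\<close>] k ..
  also have "\<dots> = (c + 2 * k) *\<^sub>C g + (2 * k - d) *\<^sub>C b"
    by (simp add: psi cvec.scale_right_distrib cvec.scale_left_distrib
        cvec.scale_left_diff_distrib)
  also have "c + 2 * k = (1 - 2 * p) * c + 2 * (1 - p) * d"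
    by (simp add: k_def algebra_simps)
  also have "2 * k - d = (1 - 2 * p) * d - 2 * p * c"
    by (simp add: k_def algebra_simps)
  finally show ?thesis unfolding b_def .
qed

text \<open>The squared norms of \<open>g\<close> and \<open>A ket0 - g\<close> are
  \<open>(sin \<theta>)\<^sup>2\<close> and \<open>(cos \<theta>)\<^sup>2\<close>, so the divisions
  normalise both vectors up to sign. In these coordinates the start has angle \<theta> and each step
  adds 2\<theta>.\<close>

lemma Q_op_funpow:
  fixes A :: "(int \<Rightarrow>\<^sub>0 'k::complex_inner) \<Rightarrow> (int \<Rightarrow>\<^sub>0 'k)"
    and \<chi> :: "int \<Rightarrow> bool"
  assumes "cinner ket0 ket0 = 1" and "unitary A"
    and p: "(sin \<theta>)\<^sup>2 = prob_good \<chi> (A ket0)"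
    and s: "sin \<theta> \<noteq> 0" and c: "cos \<theta> \<noteq> 0"
  defines "g \<equiv> good_part \<chi> (A ket0)"
  shows "(Q_op A ket0 \<chi> ^^ j) (A ket0) =
    of_real (sin ((2 * real j + 1) * \<theta>) / sin \<theta>) *\<^sub>C g +
    of_real (cos ((2 * real j + 1) * \<theta>) / cos \<theta>) *\<^sub>C (A ket0 - g)"
proof (induction j)
  case 0
  show ?case using s c by simp
next
  case (Suc j)
  define t where "t = (2 * real j + 1) * \<theta>"
  have t: "(2 * real (Suc j) + 1) * \<theta> = t + 2 * \<theta>"
    by (simp add: t_def algebra_simps)
  have q: "1 - (sin \<theta>)\<^sup>2 = (cos \<theta>)\<^sup>2"
    by (simp add: cos_squared_eq)
  \<comment> \<open>The factors on the right are the matrix entries from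
    \<open>Q_op_combination\<close> with \<open>p\<close> =
    \<open>(sin \<theta>)\<^sup>2\<close>.\<close>
  have "sin (t + 2 * \<theta>) / sin \<theta> =
      (1 - 2 * (sin \<theta>)\<^sup>2) * (sin t / sin \<theta>) + 2 * (1 - (sin \<theta>)\<^sup>2) * (cos t / cos \<theta>)"
    unfolding q unfolding sin_add cos_double_sin sin_double
    using s c by (simp add: field_simps power2_eq_square)
  moreover have "cos (t + 2 * \<theta>) / cos \<theta> =
      (1 - 2 * (sin \<theta>)\<^sup>2) * (cos t / cos \<theta>) - 2 * (sin \<theta>)\<^sup>2 * (sin t / sin \<theta>)"
    unfolding cos_add cos_double_sin sin_double
    using s c by (simp add: field_simps power2_eq_square)
  ultimately show ?case
    unfolding t funpow.simps comp_apply Suc.IH g_def Q_op_combination[OF assms(1,2)]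
      p[symmetric] t_def[symmetric]
    by simp
qed

lemma prob_good_Q_op_funpow:
  assumes "cinner ket0 ket0 = 1" and "unitary A"
    and p: "(sin \<theta>)\<^sup>2 = prob_good \<chi> (A ket0)"
    and s: "sin \<theta> \<noteq> 0" and c: "cos \<theta> \<noteq> 0"
  shows "prob_good \<chi> ((Q_op A ket0 \<chi> ^^ j) (A ket0)) = (sin ((2 * real j + 1) * \<theta>))\<^sup>2"
  unfolding Q_op_funpow[OF assms] prob_good_combination p[symmetric]
  using s by (simp add: power_divide)

text \<open>The cosine decreases on [0, pi] and sin x = cos (x - pi/2); as cos \<theta> is
  nonnegative, squaring keeps the inequality.\<close>

lemma sin_squared_ge_cos_squared:
  fixes x \<theta> :: real
  assumes "\<bar>x - pi / 2\<bar> \<le> \<theta>" and "\<theta> \<le> pi / 2"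
  shows "(sin x)\<^sup>2 \<ge> (cos \<theta>)\<^sup>2"
proof -
  have "cos \<theta> \<le> cos \<bar>x - pi / 2\<bar>"
    using assms by (intro cos_monotone_0_pi_le) auto
  also have "\<dots> = sin x"
    by (simp add: sin_cos_eq cos_abs_real) (metis cos_minus minus_diff_eq)
  finally show ?thesis
    using assms by (intro power_mono cos_ge_zero) auto
qed

theorem theorem2:
  fixes A :: "(int \<Rightarrow>\<^sub>0 'k::complex_inner) \<Rightarrow> (int \<Rightarrow>\<^sub>0 'k)"
    and ket0 :: "int \<Rightarrow>\<^sub>0 'k"
    and \<chi> :: "int \<Rightarrow> bool"
    and a \<theta> :: real
    and m :: nat
  assumes "cinner ket0 ket0 = 1"
    and "unitary A"
    and "a = prob_good \<chi> (A ket0)"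
    and "(sin \<theta>)\<^sup>2 = a" and "0 \<le> \<theta>" and "\<theta> \<le> pi / 2"
    and "a > 0"
    and "m = nat \<lfloor>pi / (4 * \<theta>)\<rfloor>"
  shows "prob_good \<chi> ((Q_op A ket0 \<chi> ^^ m) (A ket0)) \<ge> max (1 - a) a"
\<comment> \<open>At \<theta> = pi/4 the values a and 1 - a coincide. The split also leaves \<theta>
  = pi/2, where \<open>Q_op_funpow\<close> would divide by cos \<theta> = 0, to the second
  case.\<close>
proof (cases "\<theta> \<le> pi / 4")
  case True
  have "\<theta> \<noteq> 0" using assms by auto
  with \<open>0 \<le> \<theta>\<close> have pos: "\<theta> > 0" by simp
  have nz: "sin \<theta> \<noteq> 0" "cos \<theta> \<noteq> 0"
    using assms cos_gt_zero[of \<theta>] True pos pi_gt_zero by auto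
  \<comment> \<open>Multiplied by 2\<theta>, the two floor bounds place pi/2 between 2m\<theta> and
    (2m+2)\<theta>, an interval centred at (2m+1)\<theta>.\<close>
  have "real m \<le> pi / (4 * \<theta>)" "pi / (4 * \<theta>) < real m + 1"
    using pos pi_gt_zero \<open>m = _\<close> by (auto simp: of_nat_floor)
  then have "4 * (real m * \<theta>) \<le> pi" "pi < 4 * (real m * \<theta>) + 4 * \<theta>"
    using pos by (auto simp: field_simps)
  then have "\<bar>(2 * real m + 1) * \<theta> - pi / 2\<bar> \<le> \<theta>"
    by (simp add: algebra_simps abs_le_iff)
  then have "(cos \<theta>)\<^sup>2 \<le> (sin ((2 * real m + 1) * \<theta>))\<^sup>2"
    using sin_squared_ge_cos_squared \<open>\<theta> \<le> pi / 2\<close> by blast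
  moreover have "prob_good \<chi> ((Q_op A ket0 \<chi> ^^ m) (A ket0)) = (sin ((2 * real m + 1) * \<theta>))\<^sup>2"
    using assms nz by (intro prob_good_Q_op_funpow) auto
  moreover have "(cos \<theta>)\<^sup>2 = 1 - a"
    using assms by (simp add: cos_squared_eq)
  moreover have "(cos (pi / 4))\<^sup>2 \<le> (cos \<theta>)\<^sup>2"
    using True pos by (intro power_mono cos_monotone_0_pi_le cos_ge_zero) auto
  then have "1 / 2 \<le> (cos \<theta>)\<^sup>2"
    by (simp add: cos_45 power_divide)
  ultimately show ?thesis by simp
next
  case False
  with \<open>0 \<le> \<theta>\<close> have "pi / (4 * \<theta>) < 1" by (simp add: divide_less_eq)
  then have "m = 0" using \<open>m = _\<close> by (simp add: floor_le_iff)
  have "sin (pi / 4) \<le> sin \<theta>"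
    using False assms by (intro sin_monotone_2pi_le) auto
  then have "(sin (pi / 4))\<^sup>2 \<le> (sin \<theta>)\<^sup>2"
    by (intro power_mono) (auto simp: sin_45)
  then have "1 / 2 \<le> a"
    using assms by (simp add: sin_45 power_divide)
  with \<open>m = 0\<close> show ?thesis using assms by simp
qed

end
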